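(* Let $(R,[\cdot_\lambda\cdot])$ be a Leibniz conformal algebra, $Q$ a $\mathbb{C}[\partial]$-module, and $\Omega(R,Q)=(\leftharpoonup_\lambda,\rightharpoonup_\lambda,\lhd_\lambda,\rhd_\lambda,f_\lambda,\{\cdot_\lambda\cdot\})$ an extending datum of $R$ by $Q$. Then $R\natural Q$, i.e. the $\mathbb{C}[\partial]$-module $R\times Q$ with the $\lambda$-product $$[(a,x)_\lambda(b,y)]=\big([a_\lambda b]+a\leftharpoonup_\lambda y+x\rhd_\lambda b+f_\lambda(x,y),\ a\rightharpoonup_\lambda y+x\lhd_\lambda b+\{x_\lambda y\}\big),$$ is a Leibniz conformal algebra if and only if the following conditions hold for all $a,b\in R$ and $x,y,z\in Q$: (L1) $[a_\lambda b]\rightharpoonup_{\lambda+\mu}x=a\rightharpoonup_\lambda(b\rightharpoonup_\mu x)-b\rightharpoonup_\mu(a\rightharpoonup_\lambda x)$; (L2) $[a_\lambda b]\leftharpoonup_{\lambda+\mu}x=[a_\lambda(b\leftharpoonup_\mu x)]+a\leftharpoonup_\lambda(b\rightharpoonup_\mu x)-[b_\mu(a\leftharpoonup_\lambda x)]-b\leftharpoonup_\mu(a\rightharpoonup_\lambda x)$; (L3) $x\lhd_\mu[a_\lambda b]=a\rightharpoonup_\lambda(x\lhd_\mu b)-(a\rightharpoonup_\lambda x)\lhd_{\lambda+\mu}b$; (L4) $x\rhd_\mu[a_\lambda b]=[a_\lambda(x\rhd_\mu b)]+a\leftharpoonup_\lambda(x\lhd_\mu b)-[(a\leftharpoonup_\lambda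 x)_{\lambda+\mu}b]-(a\rightharpoonup_\lambda x)\rhd_{\lambda+\mu}b$; (L5) $[(x\rhd_\mu a)_{\lambda+\mu}b]+(x\lhd_\mu a)\rhd_{\lambda+\mu}b+[(a\leftharpoonup_\lambda x)_{\lambda+\mu}b]+(a\rightharpoonup_\lambda x)\rhd_{\lambda+\mu}b=0$; (L6) $(x\lhd_\mu a)\lhd_{\lambda+\mu}b+(a\rightharpoonup_\lambda x)\lhd_{\lambda+\mu}b=0$; (L7) $a\rightharpoonup_\lambda\{x_\mu y\}=\{(a\rightharpoonup_\lambda x)_{\lambda+\mu}y\}+x\lhd_\mu(a\leftharpoonup_\lambda y)+\{x_\mu(a\rightharpoonup_\lambda y)\}+(a\leftharpoonup_\lambda x)\rightharpoonup_{\lambda+\mu}y$; (L8) $a\leftharpoonup_\lambda\{x_\mu y\}=(a\leftharpoonup_\lambda x)\leftharpoonup_{\lambda+\mu}y+f_{\lambda+\mu}(a\rightharpoonup_\lambda x,y)+x\rhd_\mu(a\leftharpoonup_\lambda y)+f_\mu(x,a\rightharpoonup_\lambda y)-[a_\lambda f_\mu(x,y)]$; (L9) $(x\rhd_\mu a)\leftharpoonup_{\lambda+\mu}y+f_{\lambda+\mu}(x\lhd_\mu a,y)+(a\leftharpoonup_\lambda x)\leftharpoonup_{\lambda+\mu}y+f_{\lambda+\mu}(a\rightharpoonup_\lambda x,y)=0$; (L10) $\{(a\rightharpoonup_\lambda x)_{\lambda+\mu}y\}+(a\leftharpoonup_\lambda x)\rightharpoonup_{\lambda+\mu}y+(x\rhd_\mu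 a)\rightharpoonup_{\lambda+\mu}y+\{(x\lhd_\mu a)_{\lambda+\mu}y\}=0$; (L11) $\{x_\lambda y\}\rhd_{\lambda+\mu}a=x\rhd_\lambda(y\rhd_\mu a)+f_\lambda(x,y\lhd_\mu a)-[f_\lambda(x,y)_{\lambda+\mu}a]-y\rhd_\mu(x\rhd_\lambda a)-f_\mu(y,x\lhd_\lambda a)$; (L12) $\{x_\lambda y\}\lhd_{\lambda+\mu}a=x\lhd_\lambda(y\rhd_\mu a)+\{x_\lambda(y\lhd_\mu a)\}-y\lhd_\mu(x\rhd_\lambda a)-\{y_\mu(x\lhd_\lambda a)\}$; (L13) $x\rhd_\lambda f_\mu(y,z)=f_\lambda(x,y)\leftharpoonup_{\lambda+\mu}z+f_{\lambda+\mu}(\{x_\lambda y\},z)+y\rhd_\mu f_\lambda(x,z)+f_\mu(y,\{x_\lambda z\})-f_\lambda(x,\{y_\mu z\})$; (L14) $x\lhd_\lambda f_\mu(y,z)=f_\lambda(x,y)\rightharpoonup_{\lambda+\mu}z+y\lhd_\mu f_\lambda(x,z)+\{\{x_\lambda y\}_{\lambda+\mu}z\}+\{y_\mu\{x_\lambda z\}\}-\{x_\lambda\{y_\mu z\}\}$.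
   Context: All vector spaces are over $\mathbb{C}$; $A[\lambda]$ denotes polynomials in $\lambda$ with coefficients in the vector space $A$. Maps with values in polynomials are extended coefficientwise to polynomial arguments in other indeterminates (e.g. if $[b_\mu c]=\sum_i\mu^i d_i$ then $[a_\lambda[b_\mu c]]=\sum_i\mu^i[a_\lambda d_i]$); identities hold as polynomials in the commuting indeterminates $\lambda,\mu$. Conformal bilinear map: for $\mathbb{C}[\partial]$-modules $U,V,W$, a $\mathbb{C}$-bilinear map $f_\lambda:U\times V\to W[\lambda]$ with $f_\lambda(\partial u,v)=-\lambda f_\lambda(u,v)$ and $f_\lambda(u,\partial v)=(\partial+\lambda)f_\lambda(u,v)$. Leibniz conformal algebra: a $\mathbb{C}[\partial]$-module $R$ with a conformal bilinear map $[\cdot_\lambda\cdot]:R\times R\to R[\lambda]$ satisfying the Jacobi identity $[a_\lambda[b_\mu c]]=[[a_\lambda b]_{\lambda+\mu}c]+[b_\mu[a_\lambda c]]$ for all $a,b,c\in R$. Extending datum of $R$ by a $\mathbb{C}[\partial]$-module $Q$: a system of six conformal bilinear maps $\leftharpoonup_\lambda:R\times Q\to R[\lambda]$, $\rightharpoonup_\lambda:R\times Q\to Q[\lambda]$, $\lhd_\lambda:Q\times R\to Q[\lambda]$, $\rhd_\lambda:Q\times R\to R[\lambda]$, $f_\lambda:Q\times Q\to R[\lambda]$, $\{\cdot_\lambda\cdot\}:Q\times Q\to Q[\lambda]$. The $\mathbb{C}[\partial]$-action on $R\times Q$ is $\partial(a,x)=(\partial a,\partial x)$. *)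

theory Defs
  imports "HOL-Analysis.Analysis" "HOL-Computational_Algebra.Computational_Algebra"
begin

text \<open>
  A \<open>\<complex>[\<partial>]\<close>-module is an instance \<open>module s\<close> of the library locale whose scalars
  \<open>s :: complex poly \<Rightarrow> 'a \<Rightarrow> 'a\<close> are polynomials in \<open>\<partial>\<close>; thus \<open>\<partial>\<close> acts as \<open>s [:0, 1:]\<close> and
  the number \<open>c\<close> acts as \<open>s [:c:]\<close>. The space \<open>A[\<lambda>]\<close> is the type \<open>'a poly\<close>, on which the
  \<open>\<complex>[\<partial>]\<close>-action is coefficientwise and multiplication by \<open>\<lambda>\<close> is \<open>pCons 0\<close>.
\<close>

definition del :: "(complex poly \<Rightarrow> 'a \<Rightarrow> 'a) \<Rightarrow> 'a \<Rightarrow> 'a" where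
  "del s = s [:0, 1:]"

definition cscale :: "(complex poly \<Rightarrow> 'a \<Rightarrow> 'a) \<Rightarrow> complex \<Rightarrow> 'a \<Rightarrow> 'a" where
  "cscale s c = s [:c:]"

lemma vector_space_cscale:
  assumes "module s"
  shows "vector_space (cscale s)"
proof -
  interpret module s by fact
  show ?thesis
    by unfold_locales
      (simp_all add: cscale_def scale_right_distrib mult.commute flip: scale_left_distrib one_pCons)
qed

lemma vector_space_map_poly_cscale:
  fixes s :: "complex poly \<Rightarrow> 'a::ab_group_add \<Rightarrow> 'a"
  assumes "module s"
  shows "vector_space (\<lambda>c. map_poly (cscale s c))"
proof -
  interpret vector_space "cscale s" by (rule vector_space_cscale) fact
  show ?thesis
    by unfold_locales
      (simp_all add: poly_eq_iff coeff_map_poly scale_right_distrib scale_left_distrib)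
qed

locale conformal_bilinear = U: module sU + V: module sV + W: module sW
  for sU :: "complex poly \<Rightarrow> 'u::ab_group_add \<Rightarrow> 'u"
    and sV :: "complex poly \<Rightarrow> 'v::ab_group_add \<Rightarrow> 'v"
    and sW :: "complex poly \<Rightarrow> 'w::ab_group_add \<Rightarrow> 'w" +
  fixes f :: "'u \<Rightarrow> 'v \<Rightarrow> 'w poly"
  assumes linear_left: "Vector_Spaces.linear (cscale sU) (\<lambda>c. map_poly (cscale sW c)) (\<lambda>u. f u v)"
    and linear_right: "Vector_Spaces.linear (cscale sV) (\<lambda>c. map_poly (cscale sW c)) (f u)"
    and del_left: "f (del sU u) v = - pCons 0 (f u v)"
    and del_right: "f u (del sV v) = map_poly (del sW) (f u v) + pCons 0 (f u v)"

text \<open>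
  Two commuting indeterminates: an element of \<open>A[\<lambda>,\<mu>]\<close> is an \<open>'a poly poly\<close> whose outer
  indeterminate is \<open>\<lambda>\<close> and whose inner one is \<open>\<mu>\<close>. Since the coefficients live in a mere vector
  space, \<open>\<lambda>\<close>, \<open>\<mu>\<close> and \<open>\<lambda> + \<mu>\<close> are represented by the operators multiplying by them.
\<close>

definition lam :: "'a::ab_group_add poly poly \<Rightarrow> 'a poly poly" where
  "lam P = pCons 0 P"

definition mu :: "'a::ab_group_add poly poly \<Rightarrow> 'a poly poly" where
  "mu P = map_poly (pCons 0) P"

definition lam_mu :: "'a::ab_group_add poly poly \<Rightarrow> 'a poly poly" where
  "lam_mu P = lam P + mu P"

lemma coeff_lam: "coeff (coeff (lam P) i) j = (case i of 0 \<Rightarrow> 0 | Suc k \<Rightarrow> coeff (coeff P k) j)"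
  by (simp add: lam_def coeff_pCons split: nat.split)

lemma coeff_mu: "coeff (coeff (mu P) i) j = (case j of 0 \<Rightarrow> 0 | Suc k \<Rightarrow> coeff (coeff P i) k)"
  by (simp add: mu_def coeff_map_poly coeff_pCons split: nat.split)

text \<open>\<open>at_var T p\<close> is \<open>p\<close> with its indeterminate replaced by \<open>T \<in> {\<lambda>, \<mu>, \<lambda> + \<mu>}\<close>.\<close>

definition at_var ::
  "('a::ab_group_add poly poly \<Rightarrow> 'a poly poly) \<Rightarrow> 'a poly \<Rightarrow> 'a poly poly" where
  "at_var T p = (\<Sum>i\<le>degree p. (T ^^ i) [:[:coeff p i:]:])"

text \<open>
  Coefficientwise extension of \<open>f\<close> to polynomial arguments:
  \<open>left_ext f S T p v\<close> is \<open>f\<^bsub>S\<^esub>(p(T), v) = \<Sum>i. T\<^sup>i f\<^bsub>S\<^esub>(p\<^sub>i, v)\<close> and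
  \<open>right_ext f S u T q\<close> is \<open>f\<^bsub>S\<^esub>(u, q(T)) = \<Sum>i. T\<^sup>i f\<^bsub>S\<^esub>(u, q\<^sub>i)\<close>.
\<close>

definition left_ext ::
  "('u::ab_group_add \<Rightarrow> 'v \<Rightarrow> 'w::ab_group_add poly) \<Rightarrow> ('w poly poly \<Rightarrow> 'w poly poly) \<Rightarrow>
   ('w poly poly \<Rightarrow> 'w poly poly) \<Rightarrow> 'u poly \<Rightarrow> 'v \<Rightarrow> 'w poly poly" where
  "left_ext f S T p v = (\<Sum>i\<le>degree p. (T ^^ i) (at_var S (f (coeff p i) v)))"

definition right_ext ::
  "('u \<Rightarrow> 'v::ab_group_add \<Rightarrow> 'w::ab_group_add poly) \<Rightarrow> ('w poly poly \<Rightarrow> 'w poly poly) \<Rightarrow>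
   'u \<Rightarrow> ('w poly poly \<Rightarrow> 'w poly poly) \<Rightarrow> 'v poly \<Rightarrow> 'w poly poly" where
  "right_ext f S u T q = (\<Sum>i\<le>degree q. (T ^^ i) (at_var S (f u (coeff q i))))"

locale leibniz_conformal_algebra = conformal_bilinear sR sR sR br
  for sR :: "complex poly \<Rightarrow> 'r::ab_group_add \<Rightarrow> 'r"
    and br :: "'r \<Rightarrow> 'r \<Rightarrow> 'r poly" +
  assumes jacobi:
    "right_ext br lam a mu (br b c) = left_ext br lam_mu lam (br a b) c + right_ext br mu b lam (br a c)"

text \<open>
  An extending datum; \<open>lh\<close>, \<open>rh\<close>, \<open>lt\<close>, \<open>rt\<close>, \<open>f\<close>, \<open>cu\<close> stand for
  \<open>\<leftharpoonup>\<close>, \<open>\<rightharpoonup>\<close>, \<open>\<lhd>\<close>, \<open>\<rhd>\<close>, \<open>f\<close> and the curly bracket.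
\<close>

locale extending_datum =
  lh: conformal_bilinear sR sQ sR lh +
  rh: conformal_bilinear sR sQ sQ rh +
  lt: conformal_bilinear sQ sR sQ lt +
  rt: conformal_bilinear sQ sR sR rt +
  f: conformal_bilinear sQ sQ sR f +
  cu: conformal_bilinear sQ sQ sQ cu
  for sR :: "complex poly \<Rightarrow> 'r::ab_group_add \<Rightarrow> 'r"
    and sQ :: "complex poly \<Rightarrow> 'q::ab_group_add \<Rightarrow> 'q"
    and lh :: "'r \<Rightarrow> 'q \<Rightarrow> 'r poly"
    and rh :: "'r \<Rightarrow> 'q \<Rightarrow> 'q poly"
    and lt :: "'q \<Rightarrow> 'r \<Rightarrow> 'q poly"
    and rt :: "'q \<Rightarrow> 'r \<Rightarrow> 'r poly"
    and f :: "'q \<Rightarrow> 'q \<Rightarrow> 'r poly"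
    and cu :: "'q \<Rightarrow> 'q \<Rightarrow> 'q poly"

text \<open>The identification of \<open>R[\<lambda>] \<times> Q[\<lambda>]\<close> with \<open>(R \<times> Q)[\<lambda>]\<close>.\<close>

definition pair_poly :: "'r::ab_group_add poly \<Rightarrow> 'q::ab_group_add poly \<Rightarrow> ('r \<times> 'q) poly" where
  "pair_poly p q = map_poly (\<lambda>a. (a, 0)) p + map_poly (\<lambda>x. (0, x)) q"

lemma coeff_pair_poly: "coeff (pair_poly p q) n = (coeff p n, coeff q n)"
  by (simp add: pair_poly_def coeff_map_poly zero_prod_def)

definition natural_product ::
  "('r::ab_group_add \<Rightarrow> 'r \<Rightarrow> 'r poly) \<Rightarrow> ('r \<Rightarrow> 'q::ab_group_add \<Rightarrow> 'r poly) \<Rightarrow>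
   ('r \<Rightarrow> 'q \<Rightarrow> 'q poly) \<Rightarrow> ('q \<Rightarrow> 'r \<Rightarrow> 'q poly) \<Rightarrow> ('q \<Rightarrow> 'r \<Rightarrow> 'r poly) \<Rightarrow>
   ('q \<Rightarrow> 'q \<Rightarrow> 'r poly) \<Rightarrow> ('q \<Rightarrow> 'q \<Rightarrow> 'q poly) \<Rightarrow>
   'r \<times> 'q \<Rightarrow> 'r \<times> 'q \<Rightarrow> ('r \<times> 'q) poly" where
  "natural_product br lh rh lt rt f cu = (\<lambda>(a, x) (b, y).
     pair_poly (br a b + lh a y + rt x b + f x y) (rh a y + lt x b + cu x y))"

end

theory Submission
  imports Defs
begin

text \<open>
  The Jacobi identity of \<open>R \<natural> Q\<close> says that its jacobiator, which is additive in each of the three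
  arguments, vanishes. So it suffices to test arguments lying in \<open>R\<close> or in \<open>Q\<close>, and the two
  components of the eight resulting identities are the conditions. The triple from \<open>R\<close> is the
  Jacobi identity of \<open>R\<close>. For the triples starting in \<open>Q \<times> R\<close>, add the
  identity for the transposed first two arguments, with \<open>\<lambda>\<close> and \<open>\<mu>\<close> exchanged: what remains is
  that left multiplication by \<open>[x\<^bsub>\<mu>\<^esub> a] + [a\<^bsub>\<lambda>\<^esub> x]\<close> vanishes, which gives (L5), (L6), (L9), (L10).
\<close>

section \<open>Additivity of substitutions and of coefficientwise extensions\<close>

lemma additive_funpow:
  fixes T :: "'a::ab_group_add \<Rightarrow> 'a"
  assumes "Modules.additive T"
  shows "Modules.additive (T ^^ i)"
proof (induction i)
  case 0
  show ?case by (simp add: Modules.additive_def)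
next
  case (Suc i)
  then show ?case using assms by (simp add: Modules.additive_def)
qed

lemma additive_lam: "Modules.additive lam"
  by unfold_locales (simp add: lam_def)

lemma additive_mu: "Modules.additive mu"
  by unfold_locales (simp add: poly_eq_iff coeff_mu split: nat.split)

lemma additive_lam_mu: "Modules.additive lam_mu"
  unfolding lam_mu_def
  by unfold_locales (simp add: additive.add[OF additive_lam] additive.add[OF additive_mu])

lemmas additive_indet = additive_lam additive_mu additive_lam_mu

text \<open>Coefficients above the degree are zero and powers of an additive operator preserve zero,
  so any larger bound gives the same sum. A common bound is what allows polynomials of different
  degrees to be added term by term.\<close>

lemma at_var_le:
  assumes "Modules.additive T" "degree p \<le> n"
  shows "at_var T p = (\<Sum>i\<le>n. (T ^^ i) [:[:coeff p i:]:])"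
  unfolding at_var_def using assms(2)
  by (intro sum.mono_neutral_left)
    (auto simp: coeff_eq_0 additive.zero[OF additive_funpow[OF assms(1)]])

lemma additive_at_var:
  assumes "Modules.additive T"
  shows "Modules.additive (at_var T)"
proof
  fix p q :: "'a poly"
  let ?n = "max (degree p) (degree q)"
  have "at_var T (p + q) = (\<Sum>i\<le>?n. (T ^^ i) ([:[:coeff p i:]:] + [:[:coeff q i:]:]))"
    by (subst at_var_le[OF assms, of _ ?n]) (auto intro: degree_add_le)
  also have "\<dots> = at_var T p + at_var T q"
    by (simp only: additive.add[OF additive_funpow[OF assms]] sum.distrib
        at_var_le[OF assms, of p ?n] at_var_le[OF assms, of q ?n] max.cobounded1 max.cobounded2)
  finally show "at_var T (p + q) = at_var T p + at_var T q" .
qed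

text \<open>Additivity is all that the treatment of the Jacobi identity uses of a conformal bilinear
  map; scalars and \<partial> enter only in the proof that the product itself is conformal
  bilinear.\<close>

definition biadditive ::
  "('u::ab_group_add \<Rightarrow> 'v::ab_group_add \<Rightarrow> 'w::ab_group_add) \<Rightarrow> bool" where
  "biadditive g \<longleftrightarrow> (\<forall>v. Modules.additive (\<lambda>u. g u v)) \<and> (\<forall>u. Modules.additive (g u))"

lemma biadditiveD:
  assumes "biadditive g"
  shows "g (u + u') v = g u v + g u' v" "g u (v + v') = g u v + g u v'" "g 0 v = 0" "g u 0 = 0"
  using assms additive.add[of "\<lambda>u. g u v"] additive.zero[of "\<lambda>u. g u v"]
    additive.add[of "g u"] additive.zero[of "g u"]
  by (simp_all add: biadditive_def)

context conformal_bilinear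
begin

lemma biadditive: "biadditive f"
  unfolding biadditive_def Modules.additive_def
  using linear_left linear_right
  by (simp add: Vector_Spaces.linear_def module_hom_iff)

lemma scale_left: "f (cscale sU c u) v = map_poly (cscale sW c) (f u v)"
  using linear_left by (simp add: Vector_Spaces.linear_def module_hom_iff)

lemma scale_right: "f u (cscale sV c v) = map_poly (cscale sW c) (f u v)"
  using linear_right by (simp add: Vector_Spaces.linear_def module_hom_iff)

end

lemma left_ext_le:
  assumes "Modules.additive S" "Modules.additive T" "g 0 v = 0" "degree p \<le> n"
  shows "left_ext g S T p v = (\<Sum>i\<le>n. (T ^^ i) (at_var S (g (coeff p i) v)))"
  unfolding left_ext_def using assms(3,4)
  by (intro sum.mono_neutral_left)
    (auto simp: coeff_eq_0 additive.zero[OF additive_funpow[OF assms(2)]]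
      additive.zero[OF additive_at_var[OF assms(1)]])

text \<open>Through this symmetry each fact about \<open>right_ext\<close> is read off from the one
  about \<open>left_ext\<close>.\<close>

lemma right_ext_flip: "right_ext g S u T q = left_ext (\<lambda>v u. g u v) S T q u"
  by (simp add: right_ext_def left_ext_def)

lemma left_ext_add_poly:
  assumes ST: "Modules.additive S" "Modules.additive T" and g: "biadditive g"
  shows "left_ext g S T (p + q) v = left_ext g S T p v + left_ext g S T q v"
proof -
  let ?n = "max (degree p) (degree q)"
  have *: "left_ext g S T r v = (\<Sum>i\<le>?n. (T ^^ i) (at_var S (g (coeff r i) v)))"
    if "degree r \<le> ?n" for r
    by (rule left_ext_le[OF ST _ that]) (rule biadditiveD(3)[OF g])
  show ?thesis
    by (simp add: * degree_add_le biadditiveD(1)[OF g] additive.add[OF additive_at_var[OF ST(1)]]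
        additive.add[OF additive_funpow[OF ST(2)]] sum.distrib)
qed

lemma left_ext_add_fun:
  assumes "Modules.additive S" "Modules.additive T"
  shows "left_ext (\<lambda>u v. g u v + h u v) S T p v = left_ext g S T p v + left_ext h S T p v"
  by (simp add: left_ext_def additive.add[OF additive_at_var[OF assms(1)]]
      additive.add[OF additive_funpow[OF assms(2)]] sum.distrib)

lemma left_ext_add_arg:
  assumes ST: "Modules.additive S" "Modules.additive T" and g: "biadditive g"
  shows "left_ext g S T p (v + w) = left_ext g S T p v + left_ext g S T p w"
  by (simp add: left_ext_def biadditiveD(2)[OF g] additive.add[OF additive_at_var[OF ST(1)]]
      additive.add[OF additive_funpow[OF ST(2)]] sum.distrib)

lemma biadditive_flip: "biadditive g \<Longrightarrow> biadditive (\<lambda>v u. g u v)"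
  by (simp add: biadditive_def)

text \<open>Meant for summands of the product such as \<open>lh (fst u) (snd v)\<close>: the
  projection \<open>k\<close> moves from the map to the coefficients of \<open>p\<close>. It may
  kill leading coefficients, hence the sum with a free bound.\<close>

lemma left_ext_map_poly:
  assumes "Modules.additive S" "Modules.additive T" "biadditive g" "k 0 = 0"
  shows "left_ext (\<lambda>u v. g (k u) (l v)) S T p v = left_ext g S T (map_poly k p) (l v)"
  using left_ext_le[where g=g and v="l v", OF assms(1,2) biadditiveD(3)[OF assms(3)]
      map_poly_degree_leq[of k p]]
  by (simp add: left_ext_def coeff_map_poly assms(4))

lemmas right_ext_add_poly = left_ext_add_poly[OF _ _ biadditive_flip, folded right_ext_flip]
lemmas right_ext_add_arg = left_ext_add_arg[OF _ _ biadditive_flip, folded right_ext_flip]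

lemma right_ext_add_fun:
  assumes "Modules.additive S" "Modules.additive T"
  shows "right_ext (\<lambda>u v. g u v + h u v) S u T q = right_ext g S u T q + right_ext h S u T q"
  unfolding right_ext_flip by (rule left_ext_add_fun[OF assms])

lemma right_ext_map_poly:
  assumes "Modules.additive S" "Modules.additive T" "biadditive g" "k 0 = 0"
  shows "right_ext (\<lambda>u v. g (l u) (k v)) S u T q = right_ext g S (l u) T (map_poly k q)"
  unfolding right_ext_flip
  by (rule left_ext_map_poly[where g="\<lambda>v u. g u v" and k=k and l=l])
    (use assms in \<open>simp_all add: biadditive_flip\<close>)

lemma left_ext_zero:
  assumes "Modules.additive S" "Modules.additive T" "biadditive g"
  shows "left_ext g S T 0 v = 0" "left_ext g S T p 0 = 0"
  by (simp_all add: left_ext_def biadditiveD(3,4)[OF assms(3)]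
      additive.zero[OF additive_at_var[OF assms(1)]] additive.zero[OF additive_funpow[OF assms(2)]])

lemmas right_ext_zero = left_ext_zero[OF _ _ biadditive_flip, folded right_ext_flip]

section \<open>Additive maps compatible with the indeterminates\<close>

text \<open>
  Applied to the two projections of \<open>(R \<times> Q)[\<lambda>,\<mu>]\<close> and to the exchange of \<open>\<lambda>\<close> and \<open>\<mu>\<close>,
  which is why the indeterminates may change.
\<close>

locale poly2_map =
  fixes \<phi> :: "'a::ab_group_add poly poly \<Rightarrow> 'b::ab_group_add poly poly"
    and h :: "'a \<Rightarrow> 'b"
    and S T :: "'a poly poly \<Rightarrow> 'a poly poly"
    and S' T' :: "'b poly poly \<Rightarrow> 'b poly poly"
  assumes additive_map: "Modules.additive \<phi>"
    and map_const: "\<phi> [:[:c:]:] = [:[:h c:]:]"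
    and additive_S': "Modules.additive S'"
    and map_S: "\<phi> (S P) = S' (\<phi> P)"
    and map_T: "\<phi> (T P) = T' (\<phi> P)"
begin

lemma h_zero: "h 0 = 0"
  using map_const[of 0] additive.zero[OF additive_map] by simp

lemma map_funpow: "\<phi> ((S ^^ i) P) = (S' ^^ i) (\<phi> P)" "\<phi> ((T ^^ i) P) = (T' ^^ i) (\<phi> P)"
  by (induction i) (simp_all add: map_S map_T)

lemma map_at_var: "\<phi> (at_var S p) = at_var S' (map_poly h p)"
  \<comment> \<open>\<open>h\<close> may lower the degree of \<open>p\<close>, so the right-hand sum
    is first extended to \<open>degree p\<close>.\<close>
  by (subst at_var_le[OF additive_S' map_poly_degree_leq])
    (simp_all add: at_var_def additive.sum[OF additive_map] map_funpow map_const
      coeff_map_poly h_zero)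

lemma map_left_ext:
  "\<phi> (left_ext g S T p v) = left_ext (\<lambda>u v. map_poly h (g u v)) S' T' p v"
  by (simp add: left_ext_def additive.sum[OF additive_map] map_funpow map_at_var)

lemma map_right_ext:
  "\<phi> (right_ext g S u T q) = right_ext (\<lambda>u v. map_poly h (g u v)) S' u T' q"
  by (simp add: right_ext_flip map_left_ext)

end

section \<open>The exchange of \<lambda> and \<mu>\<close>

definition swap :: "'a::ab_group_add poly poly \<Rightarrow> 'a poly poly" where
  "swap P = (\<Sum>i\<le>degree P. map_poly (\<lambda>c. monom c i) (coeff P i))"

text \<open>The summand of \<open>swap P\<close> with index \<open>k\<close> makes the inner
  polynomial \<open>coeff P k\<close> the outer one and puts the inner monomial of degree
  \<open>k\<close> on its coefficients. So only the summand with \<open>k = j\<close>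
  contributes.\<close>

lemma coeff_swap: "coeff (coeff (swap P) i) j = coeff (coeff P j) i"
proof -
  have "coeff (coeff (swap P) i) j =
      (\<Sum>k\<le>degree P. if k = j then coeff (coeff P k) i else 0)"
    by (simp add: swap_def coeff_sum coeff_map_poly)
  \<comment> \<open>If \<open>j\<close> exceeds \<open>degree P\<close>, the sum is empty of nonzero
    terms and the right-hand side is zero too.\<close>
  also have "\<dots> = coeff (coeff P j) i"
    by (auto simp: coeff_eq_0)
  finally show ?thesis .
qed

lemma additive_swap: "Modules.additive swap"
  by unfold_locales (simp add: poly_eq_iff coeff_swap)

lemma swap_eq_0_iff: "swap P = 0 \<longleftrightarrow> P = 0"
  by (auto simp: poly_eq_iff coeff_swap)

lemma swap_indet:
  "swap (lam P) = mu (swap P)" "swap (mu P) = lam (swap P)" "swap (lam_mu P) = lam_mu (swap P)"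
  by (simp_all add: lam_mu_def poly_eq_iff coeff_swap coeff_lam coeff_mu split: nat.split)

lemma swap_const: "swap [:[:c:]:] = [:[:c:]:]"
  by (simp add: poly_eq_iff coeff_swap coeff_pCons split: nat.split)

text \<open>The operator \<open>lam_mu\<close> is kept because \<lambda> + \<mu> is
  symmetric.\<close>

lemma poly2_map_swap:
  "poly2_map swap (\<lambda>x. x) lam_mu lam lam_mu mu"
  "poly2_map swap (\<lambda>x. x) lam mu mu lam"
  "poly2_map swap (\<lambda>x. x) mu lam lam mu"
  by (simp_all add: poly2_map_def swap_indet swap_const additive_swap additive_indet)

lemma swap_ext:
  "swap (left_ext g lam_mu lam p v) = left_ext g lam_mu mu p v"
  "swap (right_ext g lam u mu q) = right_ext g mu u lam q"
  "swap (right_ext g mu u lam q) = right_ext g lam u mu q"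
  using poly2_map.map_left_ext[OF poly2_map_swap(1)] poly2_map.map_right_ext[OF poly2_map_swap(2)]
    poly2_map.map_right_ext[OF poly2_map_swap(3)]
  by simp_all

section \<open>The jacobiator and its behaviour under transposition\<close>

definition jacobiator ::
  "('e::ab_group_add \<Rightarrow> 'e \<Rightarrow> 'e poly) \<Rightarrow> 'e \<Rightarrow> 'e \<Rightarrow> 'e \<Rightarrow> 'e poly poly" where
  "jacobiator g u v w =
    right_ext g lam u mu (g v w) - left_ext g lam_mu lam (g u v) w - right_ext g mu v lam (g u w)"

lemma leibniz_conformal_algebra_iff_jacobiator:
  "leibniz_conformal_algebra s g \<longleftrightarrow>
    conformal_bilinear s s s g \<and> (\<forall>u v w. jacobiator g u v w = 0)"
  by (simp add: leibniz_conformal_algebra_def leibniz_conformal_algebra_axioms_def jacobiator_def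
      diff_diff_eq)

lemma jacobiator_add:
  assumes "biadditive g"
  shows "jacobiator g (u + u') v w = jacobiator g u v w + jacobiator g u' v w"
    and "jacobiator g u (v + v') w = jacobiator g u v w + jacobiator g u v' w"
    and "jacobiator g u v (w + w') = jacobiator g u v w + jacobiator g u v w'"
  by (simp_all add: jacobiator_def biadditiveD[OF assms] additive_indet assms
      left_ext_add_poly left_ext_add_arg right_ext_add_poly right_ext_add_arg)

text \<open>The exchange of \<lambda> and \<mu> carries the two iterated products in
  \<open>jacobiator g v u w\<close> to those in \<open>jacobiator g u v w\<close> with opposite
  signs. They cancel in the sum, leaving only the two left multiplications.\<close>

lemma swap_jacobiator:
  "swap (jacobiator g v u w) = - jacobiator g u v w
    - (left_ext g lam_mu mu (g v u) w + left_ext g lam_mu lam (g u v) w)"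
  by (simp add: jacobiator_def additive.diff[OF additive_swap] swap_ext)

text \<open>Since \<open>swap\<close> is injective, the jacobiator may be replaced by its exchanged
  form, which the assumption reduces to the left multiplications.\<close>

lemma jacobiator_transpose_eq_0_iff:
  assumes "jacobiator g u v w = 0"
  shows "jacobiator g v u w = 0 \<longleftrightarrow>
    left_ext g lam_mu mu (g v u) w + left_ext g lam_mu lam (g u v) w = 0"
  by (metis assms swap_jacobiator swap_eq_0_iff diff_0 neg_equal_0_iff_equal minus_zero)

section \<open>Components of polynomials over a product\<close>

definition map_poly2 :: "('a::zero \<Rightarrow> 'b::zero) \<Rightarrow> 'a poly poly \<Rightarrow> 'b poly poly" where
  "map_poly2 h = map_poly (map_poly h)"

lemma coeff_map_poly2:
  "h 0 = 0 \<Longrightarrow> coeff (coeff (map_poly2 h P) i) j = h (coeff (coeff P i) j)"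
  by (simp add: map_poly2_def coeff_map_poly)

lemma map_poly2_indet:
  assumes "Modules.additive h"
  shows "map_poly2 h (lam P) = lam (map_poly2 h P)" "map_poly2 h (mu P) = mu (map_poly2 h P)"
    "map_poly2 h (lam_mu P) = lam_mu (map_poly2 h P)"
  by (simp_all add: lam_mu_def poly_eq_iff coeff_map_poly2 coeff_lam coeff_mu additive.zero[OF assms]
      additive.add[OF assms] split: nat.split)

lemma additive_map_poly2:
  assumes "Modules.additive h"
  shows "Modules.additive (map_poly2 h)"
  by unfold_locales (simp add: poly_eq_iff coeff_map_poly2 additive.zero[OF assms]
      additive.add[OF assms])

lemma map_poly2_const:
  assumes "Modules.additive h"
  shows "map_poly2 h [:[:c:]:] = [:[:h c:]:]"
  by (simp add: poly_eq_iff coeff_map_poly2 coeff_pCons additive.zero[OF assms] split: nat.split)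

text \<open>These are the operator pairs of the three terms of the jacobiator, together with
  \<open>lam_mu\<close> and \<open>mu\<close>, which come from transposing the first two
  arguments.\<close>

lemma poly2_map_map_poly2:
  assumes "Modules.additive h"
  shows "poly2_map (map_poly2 h) h lam_mu lam lam_mu lam"
    and "poly2_map (map_poly2 h) h lam_mu mu lam_mu mu"
    and "poly2_map (map_poly2 h) h lam mu lam mu"
    and "poly2_map (map_poly2 h) h mu lam mu lam"
  by (simp_all add: poly2_map_def additive_map_poly2[OF assms] map_poly2_indet[OF assms]
      map_poly2_const[OF assms] additive_indet)

lemmas map_poly2_ext =
  poly2_map.map_left_ext[OF poly2_map_map_poly2(1)] poly2_map.map_left_ext[OF poly2_map_map_poly2(2)]
  poly2_map.map_right_ext[OF poly2_map_map_poly2(3)] poly2_map.map_right_ext[OF poly2_map_map_poly2(4)]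

lemma additive_fst: "Modules.additive fst" and additive_snd: "Modules.additive snd"
  by unfold_locales simp_all

lemma poly2_prod_eq_0_iff:
  fixes P :: "('a::ab_group_add \<times> 'b::ab_group_add) poly poly"
  shows "P = 0 \<longleftrightarrow> map_poly2 fst P = 0 \<and> map_poly2 snd P = 0"
  by (auto simp: poly_eq_iff coeff_map_poly2 prod_eq_iff)

lemma map_poly_natural_product:
  "map_poly fst (natural_product br lh rh lt rt f cu u v) =
    br (fst u) (fst v) + lh (fst u) (snd v) + rt (snd u) (fst v) + f (snd u) (snd v)"
  "map_poly snd (natural_product br lh rh lt rt f cu u v) =
    rh (fst u) (snd v) + lt (snd u) (fst v) + cu (snd u) (snd v)"
  by (simp_all add: natural_product_def poly_eq_iff coeff_map_poly coeff_pair_poly split: prod.split)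

lemma linear_iff_scale:
  "Vector_Spaces.linear s1 s2 g \<longleftrightarrow> vector_space s1 \<and> vector_space s2 \<and>
    (\<forall>u v. g (u + v) = g u + g v) \<and> (\<forall>c u. g (s1 c u) = s2 c (g u))"
  unfolding Vector_Spaces.linear_def module_hom_iff by (auto simp: module_iff_vector_space)

text \<open>The order of the conjuncts matters later: each triple starting in Q and then R comes
  after its transpose in the same variables, whose vanishing can therefore be assumed.\<close>

lemma jacobiator_eq_0_iff_homogeneous:
  fixes g :: "'r::ab_group_add \<times> 'q::ab_group_add \<Rightarrow> 'r \<times> 'q \<Rightarrow> ('r \<times> 'q) poly"
  assumes "biadditive g"
  shows "(\<forall>u v w. jacobiator g u v w = 0) \<longleftrightarrow>
    (\<forall>a b c x y z.
      jacobiator g (a, 0) (b, 0) (c, 0) = 0 \<and> jacobiator g (a, 0) (b, 0) (0, x) = 0 \<and>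
      jacobiator g (a, 0) (0, x) (b, 0) = 0 \<and> jacobiator g (0, x) (a, 0) (b, 0) = 0 \<and>
      jacobiator g (a, 0) (0, x) (0, y) = 0 \<and> jacobiator g (0, x) (a, 0) (0, y) = 0 \<and>
      jacobiator g (0, x) (0, y) (a, 0) = 0 \<and> jacobiator g (0, x) (0, y) (0, z) = 0)"
    (is "?L \<longleftrightarrow> ?R")
proof
  assume R: ?R
  show ?L
  proof (intro allI)
    fix u v w
    have split: "t = (fst t, 0) + (0, snd t)" for t :: "'r \<times> 'q"
      by simp
    show "jacobiator g u v w = 0"
      \<comment> \<open>Additivity expands the jacobiator into eight homogeneous terms, one for each
        type in \<open>?R\<close>.\<close>
      by (subst split[of u], subst split[of v], subst split[of w])
        (simp only: jacobiator_add[OF assms] R add_0)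
  qed
qed blast

section \<open>The product on \<open>R \<times> Q\<close> and its components\<close>

locale leibniz_extending_datum =
  extending_datum sR sQ lh rh lt rt f cu + br: leibniz_conformal_algebra sR br
  for sR :: "complex poly \<Rightarrow> 'r::ab_group_add \<Rightarrow> 'r"
    and sQ :: "complex poly \<Rightarrow> 'q::ab_group_add \<Rightarrow> 'q"
    and br lh rh lt rt f cu
begin

abbreviation np :: "'r \<times> 'q \<Rightarrow> 'r \<times> 'q \<Rightarrow> ('r \<times> 'q) poly" where
  "np \<equiv> natural_product br lh rh lt rt f cu"

lemmas biadditives = br.biadditive lh.biadditive rh.biadditive lt.biadditive rt.biadditive
  f.biadditive cu.biadditive

text \<open>Conformal bilinearity is inherited from the seven given maps without any of the
  conditions, so only the Jacobi identity is at stake in the equivalence.\<close>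

lemma conformal_bilinear_natural_product:
  "conformal_bilinear (module_prod.scale sR sQ) (module_prod.scale sR sQ) (module_prod.scale sR sQ) np"
proof -
  interpret E: module_prod sR sQ
    by (simp add: module_prod_def module_pair_def lh.U.module_axioms lh.V.module_axioms)
  interpret R: vector_space "cscale sR"
    by (rule vector_space_cscale) (rule lh.U.module_axioms)
  interpret Q: vector_space "cscale sQ"
    by (rule vector_space_cscale) (rule lh.V.module_axioms)
  have scale: "cscale E.scale c u = (cscale sR c (fst u), cscale sQ c (snd u))" for c u
    by (simp add: cscale_def E.scale_def)
  have del: "del E.scale u = (del sR (fst u), del sQ (snd u))" for u
    by (simp add: del_def E.scale_def)
  have del_add: "del sR 0 = 0" "del sQ 0 = 0" "del sR (a + b) = del sR a + del sR b"
    "del sQ (x + y) = del sQ x + del sQ y" for a b x y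
    by (simp_all add: del_def lh.U.scale_right_distrib lh.V.scale_right_distrib)
  \<comment> \<open>With the coefficients written as pairs, each required identity splits into one
    in R and one in Q, to which the rules of the given maps apply.\<close>
  have np: "coeff (np u v) n =
     (coeff (br (fst u) (fst v) + lh (fst u) (snd v) + rt (snd u) (fst v) + f (snd u) (snd v)) n,
      coeff (rh (fst u) (snd v) + lt (snd u) (fst v) + cu (snd u) (snd v)) n)" for u v n
    by (simp add: natural_product_def coeff_pair_poly split: prod.split)
  note simps = prod_eq_iff np coeff_map_poly zero_prod_def scale del del_add
    biadditives[THEN biadditiveD(1)] biadditives[THEN biadditiveD(2)]
  have "np (u + u') v = np u v + np u' v" "np u (v + v') = np u v + np u v'" for u u' v v'
    by (intro poly_eqI; simp add: simps ac_simps)+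
  moreover have "np (cscale E.scale c u) v = map_poly (cscale E.scale c) (np u v)"
    "np u (cscale E.scale c v) = map_poly (cscale E.scale c) (np u v)" for c u v
    by (intro poly_eqI; simp add: simps R.scale_right_distrib Q.scale_right_distrib
        br.scale_left lh.scale_left rh.scale_left lt.scale_left rt.scale_left f.scale_left
        cu.scale_left br.scale_right lh.scale_right rh.scale_right lt.scale_right rt.scale_right
        f.scale_right cu.scale_right)+
  moreover have "np (del E.scale u) v = - pCons 0 (np u v)"
    "np u (del E.scale v) = map_poly (del E.scale) (np u v) + pCons 0 (np u v)" for u v
    by (intro poly_eqI; simp add: simps coeff_pCons ac_simps
        br.del_left lh.del_left rh.del_left lt.del_left rt.del_left f.del_left cu.del_left
        br.del_right lh.del_right rh.del_right lt.del_right rt.del_right f.del_right cu.del_right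
        split: nat.split)+
  ultimately show ?thesis
    unfolding conformal_bilinear_def conformal_bilinear_axioms_def linear_iff_scale
    by (simp add: E.p.module_axioms vector_space_cscale vector_space_map_poly_cscale)
qed

text \<open>Extension is additive in the map, and each summand of a component is a given map
  composed with projections. The operators are doubled because the two components live over
  different coefficient spaces.\<close>

lemma left_ext_natural_product:
  assumes "Modules.additive S" "Modules.additive T" "Modules.additive S'" "Modules.additive T'"
  shows "left_ext (\<lambda>u v. map_poly fst (np u v)) S T p v =
      left_ext br S T (map_poly fst p) (fst v) + left_ext lh S T (map_poly fst p) (snd v) +
      left_ext rt S T (map_poly snd p) (fst v) + left_ext f S T (map_poly snd p) (snd v)"
    and "left_ext (\<lambda>u v. map_poly snd (np u v)) S' T' p v =
      left_ext rh S' T' (map_poly fst p) (snd v) + left_ext lt S' T' (map_poly snd p) (fst v) +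
      left_ext cu S' T' (map_poly snd p) (snd v)"
  using assms
  by (simp_all add: map_poly_natural_product left_ext_add_fun biadditives
      left_ext_map_poly[where k=fst and l=fst] left_ext_map_poly[where k=fst and l=snd]
      left_ext_map_poly[where k=snd and l=fst] left_ext_map_poly[where k=snd and l=snd])

lemma right_ext_natural_product:
  assumes "Modules.additive S" "Modules.additive T" "Modules.additive S'" "Modules.additive T'"
  shows "right_ext (\<lambda>u v. map_poly fst (np u v)) S u T q =
      right_ext br S (fst u) T (map_poly fst q) + right_ext lh S (fst u) T (map_poly snd q) +
      right_ext rt S (snd u) T (map_poly fst q) + right_ext f S (snd u) T (map_poly snd q)"
    and "right_ext (\<lambda>u v. map_poly snd (np u v)) S' u T' q =
      right_ext rh S' (fst u) T' (map_poly snd q) + right_ext lt S' (snd u) T' (map_poly fst q) +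
      right_ext cu S' (snd u) T' (map_poly snd q)"
  using assms
  by (simp_all add: map_poly_natural_product right_ext_add_fun biadditives
      right_ext_map_poly[where k=fst and l=fst] right_ext_map_poly[where k=snd and l=fst]
      right_ext_map_poly[where k=fst and l=snd] right_ext_map_poly[where k=snd and l=snd])

lemmas map_poly2_ext_natural_product =
  map_poly2_ext[OF additive_fst, where g=np, unfolded
    left_ext_natural_product(1)[OF additive_lam_mu additive_lam additive_lam_mu additive_lam]
    left_ext_natural_product(1)[OF additive_lam_mu additive_mu additive_lam_mu additive_mu]
    right_ext_natural_product(1)[OF additive_lam additive_mu additive_lam additive_mu]
    right_ext_natural_product(1)[OF additive_mu additive_lam additive_mu additive_lam]]
  map_poly2_ext[OF additive_snd, where g=np, unfolded
    left_ext_natural_product(2)[OF additive_lam_mu additive_lam additive_lam_mu additive_lam]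
    left_ext_natural_product(2)[OF additive_lam_mu additive_mu additive_lam_mu additive_mu]
    right_ext_natural_product(2)[OF additive_lam additive_mu additive_lam additive_mu]
    right_ext_natural_product(2)[OF additive_mu additive_lam additive_mu additive_lam]]

text \<open>These rules split an identity for \<open>np\<close> into its two components, distribute
  them over the given maps, and drop every term with a zero argument. On a homogeneous triple only
  the terms of the matching conditions survive.\<close>

lemmas expand_np = jacobiator_def poly2_prod_eq_0_iff
  Modules.additive.add[OF additive_map_poly2[OF additive_fst]]
  Modules.additive.add[OF additive_map_poly2[OF additive_snd]]
  Modules.additive.diff[OF additive_map_poly2[OF additive_fst]]
  Modules.additive.diff[OF additive_map_poly2[OF additive_snd]]
  map_poly2_ext_natural_product
  map_poly_natural_product biadditives[THEN biadditiveD(3)] biadditives[THEN biadditiveD(4)]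
  biadditives[THEN left_ext_zero(1)[rotated 2]] biadditives[THEN left_ext_zero(2)[rotated 2]]
  biadditives[THEN right_ext_zero(1)[rotated 2]] biadditives[THEN right_ext_zero(2)[rotated 2]]
  additive_indet

section \<open>The Jacobi identity on homogeneous triples\<close>

lemma jacobiator_RRR: "jacobiator np (a, 0) (b, 0) (c, 0) = 0"
  by (simp add: expand_np br.jacobi)

text \<open>The Q-component is (L1) and the R-component is (L2). The other triples likewise yield
  one condition from each component.\<close>

lemma jacobiator_RRQ:
  "jacobiator np (a, 0) (b, 0) (0, x) = 0 \<longleftrightarrow>
      left_ext rh lam_mu lam (br a b) x =
        right_ext rh lam a mu (rh b x) - right_ext rh mu b lam (rh a x) \<and>
      left_ext lh lam_mu lam (br a b) x =
        right_ext br lam a mu (lh b x) + right_ext lh lam a mu (rh b x)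
        - right_ext br mu b lam (lh a x) - right_ext lh mu b lam (rh a x)"
  by (auto simp: expand_np algebra_simps)

lemma jacobiator_RQR:
  "jacobiator np (a, 0) (0, x) (b, 0) = 0 \<longleftrightarrow>
      right_ext lt mu x lam (br a b) =
        right_ext rh lam a mu (lt x b) - left_ext lt lam_mu lam (rh a x) b \<and>
      right_ext rt mu x lam (br a b) =
        right_ext br lam a mu (rt x b) + right_ext lh lam a mu (lt x b)
        - left_ext br lam_mu lam (lh a x) b - left_ext rt lam_mu lam (rh a x) b"
  by (auto simp: expand_np algebra_simps)

text \<open>Under the assumption, i.e. (L3) and (L4), what remains is left multiplication by the
  symmetrized product of \<open>x\<close> and \<open>a\<close>, applied to \<open>b\<close>: its
  R-component is (L5) and its Q-component is (L6).\<close>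

lemma jacobiator_QRR:
  assumes "jacobiator np (a, 0) (0, x) (b, 0) = 0"
  shows "jacobiator np (0, x) (a, 0) (b, 0) = 0 \<longleftrightarrow>
      left_ext br lam_mu mu (rt x a) b + left_ext rt lam_mu mu (lt x a) b
        + left_ext br lam_mu lam (lh a x) b + left_ext rt lam_mu lam (rh a x) b = 0 \<and>
      left_ext lt lam_mu mu (lt x a) b + left_ext lt lam_mu lam (rh a x) b = 0"
  unfolding jacobiator_transpose_eq_0_iff[OF assms] by (auto simp: expand_np algebra_simps)

lemma jacobiator_RQQ:
  "jacobiator np (a, 0) (0, x) (0, y) = 0 \<longleftrightarrow>
      right_ext rh lam a mu (cu x y) =
        left_ext cu lam_mu lam (rh a x) y + right_ext lt mu x lam (lh a y)
        + right_ext cu mu x lam (rh a y) + left_ext rh lam_mu lam (lh a x) y \<and>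
      right_ext lh lam a mu (cu x y) =
        left_ext lh lam_mu lam (lh a x) y + left_ext f lam_mu lam (rh a x) y
        + right_ext rt mu x lam (lh a y) + right_ext f mu x lam (rh a y)
        - right_ext br lam a mu (f x y)"
  by (auto simp: expand_np algebra_simps)

text \<open>The same symmetrized left multiplication, now applied to \<open>y\<close> in Q, gives
  (L9) and (L10); the assumption amounts to (L7) and (L8).\<close>

lemma jacobiator_QRQ:
  assumes "jacobiator np (a, 0) (0, x) (0, y) = 0"
  shows "jacobiator np (0, x) (a, 0) (0, y) = 0 \<longleftrightarrow>
      left_ext lh lam_mu mu (rt x a) y + left_ext f lam_mu mu (lt x a) y
        + left_ext lh lam_mu lam (lh a x) y + left_ext f lam_mu lam (rh a x) y = 0 \<and>
      left_ext cu lam_mu lam (rh a x) y + left_ext rh lam_mu lam (lh a x) y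
        + left_ext rh lam_mu mu (rt x a) y + left_ext cu lam_mu mu (lt x a) y = 0"
  unfolding jacobiator_transpose_eq_0_iff[OF assms] by (auto simp: expand_np algebra_simps)

lemma jacobiator_QQR:
  "jacobiator np (0, x) (0, y) (a, 0) = 0 \<longleftrightarrow>
      left_ext rt lam_mu lam (cu x y) a =
        right_ext rt lam x mu (rt y a) + right_ext f lam x mu (lt y a)
        - left_ext br lam_mu lam (f x y) a
        - right_ext rt mu y lam (rt x a) - right_ext f mu y lam (lt x a) \<and>
      left_ext lt lam_mu lam (cu x y) a =
        right_ext lt lam x mu (rt y a) + right_ext cu lam x mu (lt y a)
        - right_ext lt mu y lam (rt x a) - right_ext cu mu y lam (lt x a)"
  by (auto simp: expand_np algebra_simps)

lemma jacobiator_QQQ: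
  "jacobiator np (0, x) (0, y) (0, z) = 0 \<longleftrightarrow>
      right_ext rt lam x mu (f y z) =
        left_ext lh lam_mu lam (f x y) z + left_ext f lam_mu lam (cu x y) z
        + right_ext rt mu y lam (f x z) + right_ext f mu y lam (cu x z)
        - right_ext f lam x mu (cu y z) \<and>
      right_ext lt lam x mu (f y z) =
        left_ext rh lam_mu lam (f x y) z + right_ext lt mu y lam (f x z)
        + left_ext cu lam_mu lam (cu x y) z + right_ext cu mu y lam (cu x z)
        - right_ext cu lam x mu (cu y z)"
  by (auto simp: expand_np algebra_simps)

end

theorem theorem3p2:
  fixes sR :: "complex poly \<Rightarrow> 'r::ab_group_add \<Rightarrow> 'r"
    and sQ :: "complex poly \<Rightarrow> 'q::ab_group_add \<Rightarrow> 'q"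
    and br :: "'r \<Rightarrow> 'r \<Rightarrow> 'r poly"
    and lh :: "'r \<Rightarrow> 'q \<Rightarrow> 'r poly"
    and rh :: "'r \<Rightarrow> 'q \<Rightarrow> 'q poly"
    and lt :: "'q \<Rightarrow> 'r \<Rightarrow> 'q poly"
    and rt :: "'q \<Rightarrow> 'r \<Rightarrow> 'r poly"
    and f :: "'q \<Rightarrow> 'q \<Rightarrow> 'r poly"
    and cu :: "'q \<Rightarrow> 'q \<Rightarrow> 'q poly"
  assumes R: "leibniz_conformal_algebra sR br"
    and Q: "module sQ"
    and datum: "extending_datum sR sQ lh rh lt rt f cu"
  shows "leibniz_conformal_algebra (module_prod.scale sR sQ) (natural_product br lh rh lt rt f cu) \<longleftrightarrow>
    (\<forall>a b x y z.
      \<comment> \<open>L1\<close>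
      left_ext rh lam_mu lam (br a b) x =
        right_ext rh lam a mu (rh b x) - right_ext rh mu b lam (rh a x) \<and>
      \<comment> \<open>L2\<close>
      left_ext lh lam_mu lam (br a b) x =
        right_ext br lam a mu (lh b x) + right_ext lh lam a mu (rh b x)
        - right_ext br mu b lam (lh a x) - right_ext lh mu b lam (rh a x) \<and>
      \<comment> \<open>L3\<close>
      right_ext lt mu x lam (br a b) =
        right_ext rh lam a mu (lt x b) - left_ext lt lam_mu lam (rh a x) b \<and>
      \<comment> \<open>L4\<close>
      right_ext rt mu x lam (br a b) =
        right_ext br lam a mu (rt x b) + right_ext lh lam a mu (lt x b)
        - left_ext br lam_mu lam (lh a x) b - left_ext rt lam_mu lam (rh a x) b \<and>
      \<comment> \<open>L5\<close>
      left_ext br lam_mu mu (rt x a) b + left_ext rt lam_mu mu (lt x a) b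
        + left_ext br lam_mu lam (lh a x) b + left_ext rt lam_mu lam (rh a x) b = 0 \<and>
      \<comment> \<open>L6\<close>
      left_ext lt lam_mu mu (lt x a) b + left_ext lt lam_mu lam (rh a x) b = 0 \<and>
      \<comment> \<open>L7\<close>
      right_ext rh lam a mu (cu x y) =
        left_ext cu lam_mu lam (rh a x) y + right_ext lt mu x lam (lh a y)
        + right_ext cu mu x lam (rh a y) + left_ext rh lam_mu lam (lh a x) y \<and>
      \<comment> \<open>L8\<close>
      right_ext lh lam a mu (cu x y) =
        left_ext lh lam_mu lam (lh a x) y + left_ext f lam_mu lam (rh a x) y
        + right_ext rt mu x lam (lh a y) + right_ext f mu x lam (rh a y)
        - right_ext br lam a mu (f x y) \<and>
      \<comment> \<open>L9\<close>
      left_ext lh lam_mu mu (rt x a) y + left_ext f lam_mu mu (lt x a) y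
        + left_ext lh lam_mu lam (lh a x) y + left_ext f lam_mu lam (rh a x) y = 0 \<and>
      \<comment> \<open>L10\<close>
      left_ext cu lam_mu lam (rh a x) y + left_ext rh lam_mu lam (lh a x) y
        + left_ext rh lam_mu mu (rt x a) y + left_ext cu lam_mu mu (lt x a) y = 0 \<and>
      \<comment> \<open>L11\<close>
      left_ext rt lam_mu lam (cu x y) a =
        right_ext rt lam x mu (rt y a) + right_ext f lam x mu (lt y a)
        - left_ext br lam_mu lam (f x y) a
        - right_ext rt mu y lam (rt x a) - right_ext f mu y lam (lt x a) \<and>
      \<comment> \<open>L12\<close>
      left_ext lt lam_mu lam (cu x y) a =
        right_ext lt lam x mu (rt y a) + right_ext cu lam x mu (lt y a)
        - right_ext lt mu y lam (rt x a) - right_ext cu mu y lam (lt x a) \<and>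
      \<comment> \<open>L13\<close>
      right_ext rt lam x mu (f y z) =
        left_ext lh lam_mu lam (f x y) z + left_ext f lam_mu lam (cu x y) z
        + right_ext rt mu y lam (f x z) + right_ext f mu y lam (cu x z)
        - right_ext f lam x mu (cu y z) \<and>
      \<comment> \<open>L14\<close>
      right_ext lt lam x mu (f y z) =
        left_ext rh lam_mu lam (f x y) z + right_ext lt mu y lam (f x z)
        + left_ext cu lam_mu lam (cu x y) z + right_ext cu mu y lam (cu x z)
        - right_ext cu lam x mu (cu y z))"
proof -
  interpret leibniz_extending_datum sR sQ br lh rh lt rt f cu
    by (intro leibniz_extending_datum.intro datum R)
  show ?thesis
    unfolding leibniz_conformal_algebra_iff_jacobiator
      jacobiator_eq_0_iff_homogeneous[OF conformal_bilinear.biadditive[OF conformal_bilinear_natural_product]]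
    using conformal_bilinear_natural_product
    \<comment> \<open>By \<open>conj_cong\<close> the conjuncts already rewritten are available to
      the later ones. This discharges the assumptions of \<open>jacobiator_QRR\<close> and
      \<open>jacobiator_QRQ\<close>, which \<open>jacobiator_RQR\<close> and
      \<open>jacobiator_RQQ\<close> turn into (L3), (L4) and (L7), (L8).\<close>
    by (simp only: jacobiator_RRR jacobiator_RRQ jacobiator_RQR jacobiator_QRR jacobiator_RQQ
        jacobiator_QRQ jacobiator_QQR jacobiator_QQQ conj_assoc simp_thms cong: conj_cong)
qed

end
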